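(* Let $p,q$ be complex numbers. The generating function of the products $Q_{p,q,n}Q_{p,q,2n+1}$ of $(p,q)$-Pell Lucas numbers is, as a formal power series in $z$, $$\sum_{n=0}^{\infty}Q_{p,q,n}Q_{p,q,2n+1}z^n=\frac{4p-4p^2(4p^2+q)z+12pq^2(2p^2+q)z^2-4p^2q^4z^3}{1-4p(2p^2+q)z-2q(8p^4+6p^2q+q^2)z^2+4pq^3(2p^2+q)z^3+q^6z^4}.$$
   Context: The $(p,q)$-Pell Lucas numbers are defined by $Q_{p,q,0}=2$, $Q_{p,q,1}=2p$, and $Q_{p,q,n}=2pQ_{p,q,n-1}+qQ_{p,q,n-2}$ for $n\ge 2$. *)

theory Defs
  imports Complex_Main "HOL-Computational_Algebra.Formal_Power_Series"
begin

fun pell_lucas :: "complex \<Rightarrow> complex \<Rightarrow> nat \<Rightarrow> complex" where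
  "pell_lucas p q 0 = 2"
| "pell_lucas p q (Suc 0) = 2 * p"
| "pell_lucas p q (Suc (Suc n)) = 2 * p * pell_lucas p q (Suc n) + q * pell_lucas p q n"

end

theory Submission imports Defs begin

text \<open>
  Let \<open>a, b\<close> be the roots of \<open>x^2 = 2 p x + q\<close>. Then \<open>Q_n Q_{2n+1}\<close> is a linear combination of the
  \<open>n\<close>-th powers of \<open>a^3, a^2 b, a b^2, b^3\<close>, so it satisfies the recurrence of order four whose
  characteristic polynomial has these roots; its reversal is the denominator. Multiplying out,
  the recurrence annihilates all coefficients from the fourth on, and the remaining ones are read
  off the initial values.
\<close>

text \<open>With \<open>a + b = 2p\<close> and \<open>ab = -q\<close>, the characteristic polynomial
  is \<open>(x^2 - (8p^3 + 6pq) x - q^3) (x^2 + 2pq x - q^3)\<close>; the factors have roots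
  \<open>a^3, b^3\<close> and \<open>a^2 b, a b^2\<close>.\<close>

lemma pell_lucas_product_recurrence:
  fixes p q :: complex
  defines "f \<equiv> \<lambda>n. pell_lucas p q n * pell_lucas p q (2 * n + 1)"
  shows "f (n + 4) = 4 * p * (2 * p^2 + q) * f (n + 3)
    + 2 * q * (8 * p^4 + 6 * p^2 * q + q^2) * f (n + 2)
    - 4 * p * q^3 * (2 * p^2 + q) * f (n + 1) - q^6 * f n"
proof -
  define x where "x k = pell_lucas p q (n + k)" for k
  define u where "u k = pell_lucas p q (2 * (n + k) + 1)" for k
  have x: "x (Suc (Suc k)) = 2 * p * x (Suc k) + q * x k" for k
    by (simp add: x_def)
  \<comment> \<open>Passing to every second index squares the roots:
    \<open>a^2 + b^2 = 4p^2 + 2q\<close> and \<open>(ab)^2 = q^2\<close>.\<close>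
  have u: "u (Suc (Suc k)) = (4 * p^2 + 2 * q) * u (Suc k) - q^2 * u k" for k
    by (simp add: u_def algebra_simps power2_eq_square)
  have f: "f (n + k) = x k * u k" for k
    by (simp add: f_def x_def u_def)
  \<comment> \<open>Linear in \<open>x 0, x 1\<close> and in \<open>u 0, u 1\<close>, this holds for arbitrary initial values.\<close>
  have "x 4 * u 4 = 4 * p * (2 * p^2 + q) * (x 3 * u 3)
    + 2 * q * (8 * p^4 + 6 * p^2 * q + q^2) * (x 2 * u 2)
    - 4 * p * q^3 * (2 * p^2 + q) * (x 1 * u 1) - q^6 * (x 0 * u 0)"
    by (simp add: x u eval_nat_numeral) (simp add: algebra_simps)
  then show ?thesis
    using f[of 0] by (simp only: f add_0_right)
qed

theorem theorem15:
  fixes p q :: complex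
  shows "Abs_fps (\<lambda>n. pell_lucas p q n * pell_lucas p q (2 * n + 1)) =
    (fps_const (4 * p) - fps_const (4 * p^2 * (4 * p^2 + q)) * fps_X
       + fps_const (12 * p * q^2 * (2 * p^2 + q)) * fps_X^2
       - fps_const (4 * p^2 * q^4) * fps_X^3) /
    (1 - fps_const (4 * p * (2 * p^2 + q)) * fps_X
       - fps_const (2 * q * (8 * p^4 + 6 * p^2 * q + q^2)) * fps_X^2
       + fps_const (4 * p * q^3 * (2 * p^2 + q)) * fps_X^3
       + fps_const (q^6) * fps_X^4)"
    (is "?F = ?N / ?D")
proof -
  have FD: "?F * ?D = ?N"
  proof (rule fps_ext)
    fix n
    define f where "f n = pell_lucas p q n * pell_lucas p q (2 * n + 1)" for n
    \<comment> \<open>The guards encode the zero coefficients of \<open>fps_X^k * ?F\<close> below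
      degree \<open>k\<close>, where \<open>n - k\<close> would truncate to 0.\<close>
    have D: "fps_nth (?F * ?D) n = f n
      - 4 * p * (2 * p^2 + q) * (if n < 1 then 0 else f (n - 1))
      - 2 * q * (8 * p^4 + 6 * p^2 * q + q^2) * (if n < 2 then 0 else f (n - 2))
      + 4 * p * q^3 * (2 * p^2 + q) * (if n < 3 then 0 else f (n - 3))
      + q^6 * (if n < 4 then 0 else f (n - 4))"
      unfolding f_def
      by (subst mult.commute)
        (simp only: distrib_right left_diff_distrib mult_1_left mult.assoc fps_add_nth fps_sub_nth
          fps_mult_left_const_nth fps_X_power_mult_nth fps_X_mult_nth fps_nth_Abs_fps less_one)
    have N: "fps_nth ?N n = (if n = 0 then 4 * p else 0)
      - 4 * p^2 * (4 * p^2 + q) * (if n = 1 then 1 else 0)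
      + 12 * p * q^2 * (2 * p^2 + q) * (if n = 2 then 1 else 0)
      - 4 * p^2 * q^4 * (if n = 3 then 1 else 0)"
      by (simp only: fps_add_nth fps_sub_nth fps_mult_left_const_nth fps_X_power_nth fps_X_nth
          fps_nth_fps_const)
    consider "n = 0" | "n = 1" | "n = 2" | "n = 3" | "n \<ge> 4"
      by linarith
    then show "fps_nth (?F * ?D) n = fps_nth ?N n"
    proof cases
      case 1
      then show ?thesis
        unfolding D N f_def by simp
    next
      case 2
      then show ?thesis
        unfolding D N f_def by (simp add: eval_nat_numeral) (simp add: algebra_simps)
    next
      case 3
      then show ?thesis
        unfolding D N f_def by (simp add: eval_nat_numeral) (simp add: algebra_simps)
    next
      case 4
      then show ?thesis
        unfolding D N f_def by (simp add: eval_nat_numeral) (simp add: algebra_simps)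
    next
      case 5
      then obtain m where m: "n = m + 4"
        by (metis add.commute le_iff_add)
      show ?thesis
        \<comment> \<open>All guards are now false and the numerator coefficient is 0, so the goal
          is the recurrence rearranged.\<close>
        using pell_lucas_product_recurrence[of p q m, folded f_def]
        unfolding D N unfolding m by (simp add: add.commute)
    qed
  qed
  \<comment> \<open>The constant term of \<open>?D\<close> is 1 for all \<open>p, q\<close>, so
    \<open>?D\<close> can be cancelled.\<close>
  have "fps_nth ?D 0 \<noteq> fps_nth 0 0"
    by simp
  then have "?D \<noteq> 0"
    by metis
  from nonzero_mult_div_cancel_right[OF this, of ?F] show ?thesis
    unfolding FD by (rule sym)
qed

end
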